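(* In the variety of $2$-dimensional Leibniz--Poisson algebras over $\mathbb C$, for the parametric families $L_5^{*}=\{L_5^{\alpha}\}_{\alpha\in\mathbb C}$, $L_6^{*}=\{L_6^{\alpha}\}_{\alpha\in\mathbb C}$, $L_7^{*}=\{L_7^{\alpha}\}_{\alpha\in\mathbb C}$ one has: (i) $\overline{\bigcup_{\alpha}O(L_5^{\alpha})}$ contains $\overline{O(L_7^{\alpha})}$ for every $\alpha\in\mathbb C$, $\overline{O(L_2)}$, $\overline{O(L_1)}$ and $\overline{O(\mathbb C^8)}$; (ii) $\overline{\bigcup_{\alpha}O(L_6^{\alpha})}$ contains $\overline{O(L_7^{\alpha})}$ for every $\alpha\in\mathbb C$, $\overline{O(L_2)}$, $\overline{O(L_1)}$ and $\overline{O(\mathbb C^8)}$; (iii) $\overline{\bigcup_{\alpha}O(L_7^{\alpha})}$ contains $\overline{O(L_1)}$ and $\overline{O(\mathbb C^8)}$.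
   Context: A Leibniz--Poisson algebra is a complex vector space with a commutative associative product $\cdot$ and a bilinear bracket $[-,-]$ satisfying $[[x,y],z]=[[x,z],y]+[x,[y,z]]$ and $[x\cdot y,z]=[x,z]\cdot y+x\cdot[y,z]$. Fix a $2$-dimensional complex vector space $V$ with basis $e_1,e_2$. A $2$-dimensional such algebra is viewed as a pair $(\mu,\mu')\in \mathrm{Bil}(V\times V,V)^2\cong\mathbb C^{16}$ ($\mu$ is $\cdot$, $\mu'$ is the bracket). $\mathrm{GL}(V)$ acts by $(g*(\mu,\mu'))(x,y)=(g\mu(g^{-1}x,g^{-1}y),\,g\mu'(g^{-1}x,g^{-1}y))$; $O(T)$ is the orbit of a structure representing $T$; closures are Zariski closures. The algebras are (unlisted products are zero, $\cdot$ is commutative): $L_1: [e_1,e_1]=e_2$; $L_2: [e_1,e_2]=e_1$; $L_5^{\alpha}: e_1\cdot e_1=e_1,\ e_1\cdot e_2=e_2,\ [e_2,e_1]=\alpha e_2$; $L_6^{\alpha}: e_1\cdot e_1=e_1,\ [e_2,e_1]=\alpha e_2$; $L_7^{\alpha}: e_1\cdot e_1=e_2,\ [e_1,e_1]=\alpha e_2$; $\mathbb C^8$: the algebra with both products zero. *)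

theory Defs
  imports "HOL-Analysis.Analysis"
begin

type_synonym vec2 = "complex^2"
type_synonym bstruct = "(vec2 \<Rightarrow> vec2 \<Rightarrow> vec2) \<times> (vec2 \<Rightarrow> vec2 \<Rightarrow> vec2)"

definition e1 :: vec2 where "e1 = axis 1 1"
definition e2 :: vec2 where "e2 = axis 2 1"

(* Complex linearity: the library constant linear without a qualifier is only real linearity. *)
abbreviation clin :: "(vec2 \<Rightarrow> vec2) \<Rightarrow> bool"
  where "clin \<equiv> Vector_Spaces.linear (*s) (*s)"

definition Bil :: "(vec2 \<Rightarrow> vec2 \<Rightarrow> vec2) set"
  where "Bil = {\<mu>. (\<forall>y. clin (\<lambda>x. \<mu> x y)) \<and> (\<forall>x. clin (\<lambda>y. \<mu> x y))}"

definition GL :: "(vec2 \<Rightarrow> vec2) set"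
  where "GL = {g. clin g \<and> bij g}"

fun act :: "(vec2 \<Rightarrow> vec2) \<Rightarrow> bstruct \<Rightarrow> bstruct"
  where "act g (\<mu>, \<mu>') =
    ((\<lambda>x y. g (\<mu> (inv g x) (inv g y))), (\<lambda>x y. g (\<mu>' (inv g x) (inv g y))))"

definition orbit :: "bstruct \<Rightarrow> bstruct set"
  where "orbit p = (\<lambda>g. act g p) ` GL"

definition LP :: "bstruct set"
  where "LP = {(\<mu>, \<mu>') \<in> Bil \<times> Bil.
    (\<forall>x y. \<mu> x y = \<mu> y x) \<and>
    (\<forall>x y z. \<mu> (\<mu> x y) z = \<mu> x (\<mu> y z)) \<and>
    (\<forall>x y z. \<mu>' (\<mu>' x y) z = \<mu>' (\<mu>' x z) y + \<mu>' x (\<mu>' y z)) \<and>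
    (\<forall>x y z. \<mu>' (\<mu> x y) z = \<mu> (\<mu>' x z) y + \<mu> x (\<mu>' y z))}"

(* Polynomial functions in the 16 bstruct constants. *)
inductive_set PolyFun :: "(bstruct \<Rightarrow> complex) set" where
  const: "(\<lambda>p. c) \<in> PolyFun"
| coord_fst: "(\<lambda>p. fst p (axis i 1) (axis j 1) $ k) \<in> PolyFun"
| coord_snd: "(\<lambda>p. snd p (axis i 1) (axis j 1) $ k) \<in> PolyFun"
| add: "f \<in> PolyFun \<Longrightarrow> g \<in> PolyFun \<Longrightarrow> (\<lambda>p. f p + g p) \<in> PolyFun"
| mult: "f \<in> PolyFun \<Longrightarrow> g \<in> PolyFun \<Longrightarrow> (\<lambda>p. f p * g p) \<in> PolyFun"

definition zeros :: "(bstruct \<Rightarrow> complex) set \<Rightarrow> bstruct set"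
  where "zeros F = {p \<in> Bil \<times> Bil. \<forall>f\<in>F. f p = 0}"

definition zariski :: "bstruct topology"
  where "zariski = topology (\<lambda>U. \<exists>F\<subseteq>PolyFun. U = Bil \<times> Bil - zeros F)"

(* Closure inside the variety. As LP is closed (closedin_LP below), for subsets of LP it is
   also the closure in the whole space of pairs of bilinear maps (zcl_eq below). *)
definition zcl :: "bstruct set \<Rightarrow> bstruct set"
  where "zcl S = subtopology zariski LP closure_of S"

(* The bilinear map whose values on (e1,e1), (e1,e2), (e2,e1), (e2,e2) are the four arguments. *)
definition bil :: "vec2 \<Rightarrow> vec2 \<Rightarrow> vec2 \<Rightarrow> vec2 \<Rightarrow> vec2 \<Rightarrow> vec2 \<Rightarrow> vec2"
  where "bil a b c d = (\<lambda>x y.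
    (x$1 * y$1) *s a + (x$1 * y$2) *s b + (x$2 * y$1) *s c + (x$2 * y$2) *s d)"

definition L1 :: bstruct where "L1 = (bil 0 0 0 0, bil e2 0 0 0)"
definition L2 :: bstruct where "L2 = (bil 0 0 0 0, bil 0 e1 0 0)"
definition L5 :: "complex \<Rightarrow> bstruct" where "L5 \<alpha> = (bil e1 e2 e2 0, bil 0 0 (\<alpha> *s e2) 0)"
definition L6 :: "complex \<Rightarrow> bstruct" where "L6 \<alpha> = (bil e1 0 0 0, bil 0 0 (\<alpha> *s e2) 0)"
definition L7 :: "complex \<Rightarrow> bstruct" where "L7 \<alpha> = (bil e2 0 0 0, bil (\<alpha> *s e2) 0 0 0)"
definition C8 :: bstruct where "C8 = (bil 0 0 0 0, bil 0 0 0 0)"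

lemma clin_iff: "clin f \<longleftrightarrow> (\<forall>x y. f (x + y) = f x + f y) \<and> (\<forall>c x. f (c *s x) = c *s f x)"
  unfolding Vector_Spaces.linear_def module_hom_def module_hom_axioms_def
  using vec.vector_space_axioms vec.module_axioms by auto

lemma bil_basis [simp]:
  "bil a b c d e1 e1 = a" "bil a b c d e1 e2 = b" "bil a b c d e2 e1 = c" "bil a b c d e2 e2 = d"
  by (simp_all add: bil_def e1_def e2_def axis_def)

lemma bil_in_Bil: "bil a b c d \<in> Bil"
  by (simp add: Bil_def clin_iff bil_def vec_eq_iff algebra_simps)

lemma structures_in_LP:
  "L1 \<in> LP" "L2 \<in> LP" "L5 \<alpha> \<in> LP" "L6 \<alpha> \<in> LP" "L7 \<alpha> \<in> LP" "C8 \<in> LP"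
  unfolding LP_def L1_def L2_def L5_def L6_def L7_def C8_def
  by (simp_all add: bil_in_Bil, simp_all add: bil_def e1_def e2_def axis_def vec_eq_iff
      forall_2 algebra_simps)

lemma LP_iff: "(m, n) \<in> LP \<longleftrightarrow> m \<in> Bil \<and> n \<in> Bil \<and>
    (\<forall>x y. m x y = m y x) \<and>
    (\<forall>x y z. m (m x y) z = m x (m y z)) \<and>
    (\<forall>x y z. n (n x y) z = n (n x z) y + n x (n y z)) \<and>
    (\<forall>x y z. n (m x y) z = m (n x z) y + m x (n y z))"
  by (simp add: LP_def)

lemma act_LP:
  assumes "p \<in> LP" "g \<in> GL"
  shows "act g p \<in> LP"
proof -
  obtain m n where p: "p = (m, n)" by force
  have g: "\<And>x y. g (x + y) = g x + g y" "\<And>c x. g (c *s x) = c *s g x" "bij g"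
    using assms by (auto simp: GL_def clin_iff)
  have i: "inv g (g x) = x" "g (inv g x) = x" for x
    using g(3) by (simp_all add: bij_is_inj bij_is_surj surj_f_inv_f)
  have i1: "inv g (x + y) = inv g x + inv g y" for x y by (metis g(1) i)
  have i2: "inv g (c *s y) = c *s inv g y" for c y by (metis g(2) i)
  have B: "(\<lambda>x y. g (q (inv g x) (inv g y))) \<in> Bil" if "q \<in> Bil" for q
    using that by (simp add: Bil_def clin_iff i1 i2 g(1,2))
  have Bil: "m \<in> Bil" "n \<in> Bil"
    and "\<forall>x y. m x y = m y x" "\<forall>x y z. m (m x y) z = m x (m y z)"
    "\<forall>x y z. n (n x y) z = n (n x z) y + n x (n y z)"
    "\<forall>x y z. n (m x y) z = m (n x z) y + m x (n y z)"
    using assms(1) unfolding p LP_iff by - (elim conjE, assumption)+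
  note LP = this(3-)[rule_format]
  show ?thesis unfolding p act.simps LP_iff i g(1)[symmetric]
    by (intro conjI allI B Bil; rule arg_cong[of _ _ g], rule LP)
qed

lemma orbit_LP: "p \<in> LP \<Longrightarrow> orbit p \<subseteq> LP"
  by (auto simp: orbit_def act_LP)

lemma istopology_zariski: "istopology (\<lambda>U. \<exists>F\<subseteq>PolyFun. U = Bil \<times> Bil - zeros F)"
  unfolding istopology_def
proof (intro conjI allI impI)
  fix S T
  assume "\<exists>F\<subseteq>PolyFun. S = Bil \<times> Bil - zeros F" "\<exists>F\<subseteq>PolyFun. T = Bil \<times> Bil - zeros F"
  then obtain F G where FG: "F \<subseteq> PolyFun" "G \<subseteq> PolyFun"
    "S = Bil \<times> Bil - zeros F" "T = Bil \<times> Bil - zeros G" by blast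
  let ?H = "(\<lambda>(f, g) p. f p * g p) ` (F \<times> G)"
  have "?H \<subseteq> PolyFun" using FG by (auto intro: PolyFun.mult)
  moreover have "S \<inter> T = Bil \<times> Bil - zeros ?H"
    unfolding FG by (auto simp: zeros_def)
  ultimately show "\<exists>F\<subseteq>PolyFun. S \<inter> T = Bil \<times> Bil - zeros F" by blast
next
  fix K
  assume "\<forall>S\<in>K. \<exists>F\<subseteq>PolyFun. S = Bil \<times> Bil - zeros F"
  then have "\<exists>F. \<forall>S\<in>K. F S \<subseteq> PolyFun \<and> S = Bil \<times> Bil - zeros (F S)"
    by (intro bchoice) blast
  then obtain F where F: "\<And>S. S \<in> K \<Longrightarrow> F S \<subseteq> PolyFun \<and> S = Bil \<times> Bil - zeros (F S)"
    by blast
  have "\<Union>K = Bil \<times> Bil - zeros (\<Union>S\<in>K. F S)"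
  proof (intro set_eqI iffI)
    fix p assume "p \<in> \<Union>K"
    then obtain S where S: "S \<in> K" "p \<in> S" by blast
    then have "p \<in> Bil \<times> Bil - zeros (F S)" using F by blast
    then show "p \<in> Bil \<times> Bil - zeros (\<Union>S\<in>K. F S)" using S(1) by (auto simp: zeros_def)
  next
    fix p assume "p \<in> Bil \<times> Bil - zeros (\<Union>S\<in>K. F S)"
    then obtain S where S: "S \<in> K" "p \<in> Bil \<times> Bil - zeros (F S)" by (auto simp: zeros_def)
    then have "p \<in> S" using F by blast
    then show "p \<in> \<Union>K" using S(1) by blast
  qed
  moreover have "(\<Union>S\<in>K. F S) \<subseteq> PolyFun" using F by blast
  ultimately show "\<exists>F\<subseteq>PolyFun. \<Union>K = Bil \<times> Bil - zeros F" by blast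
qed

lemma openin_zariski: "openin zariski U \<longleftrightarrow> (\<exists>F\<subseteq>PolyFun. U = Bil \<times> Bil - zeros F)"
  by (simp add: zariski_def istopology_zariski topology_inverse')

lemma topspace_zariski: "topspace zariski = Bil \<times> Bil"
proof -
  have "zeros {\<lambda>p. 1} = {}" by (auto simp: zeros_def)
  then have "openin zariski (Bil \<times> Bil)"
    unfolding openin_zariski by (metis Diff_empty PolyFun.const empty_subsetI insert_subset)
  then show ?thesis
    by (metis Diff_subset openin_subset openin_topspace openin_zariski subset_antisym)
qed

lemma closedin_zariski: "closedin zariski Z \<longleftrightarrow> (\<exists>F\<subseteq>PolyFun. Z = zeros F)"
proof -
  have "zeros F \<subseteq> Bil \<times> Bil" for F by (auto simp: zeros_def)
  then show ?thesis
    unfolding closedin_def topspace_zariski openin_zariski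
    by (metis Diff_Diff_Int inf.absorb_iff2)
qed

definition regular :: "(bstruct \<Rightarrow> vec2) \<Rightarrow> bool"
  where "regular u \<longleftrightarrow> (\<forall>k. \<exists>f\<in>PolyFun. \<forall>p\<in>Bil \<times> Bil. u p $ k = f p)"

lemma regular_const: "regular (\<lambda>p. v)"
  unfolding regular_def by (metis PolyFun.const)

lemma regular_add:
  assumes "regular u" "regular v" shows "regular (\<lambda>p. u p + v p)"
  unfolding regular_def
proof
  fix k
  obtain f g where "f \<in> PolyFun" "g \<in> PolyFun"
    "\<forall>p\<in>Bil \<times> Bil. u p $ k = f p" "\<forall>p\<in>Bil \<times> Bil. v p $ k = g p"
    using assms unfolding regular_def by metis
  then show "\<exists>h\<in>PolyFun. \<forall>p\<in>Bil \<times> Bil. (u p + v p) $ k = h p"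
    by (intro bexI[of _ "\<lambda>p. f p + g p"]) (simp_all add: PolyFun.add)
qed

lemma Bil_expand:
  assumes "m \<in> Bil"
  shows "m x y = bil (m e1 e1) (m e1 e2) (m e2 e1) (m e2 e2) x y"
proof -
  have e: "z = z$1 *s e1 + z$2 *s e2" for z :: vec2
    by (simp add: vec_eq_iff forall_2 e1_def e2_def axis_def)
  have a: "m (u + v) w = m u w + m v w" "m u (v + w) = m u v + m u w"
    "m (c *s u) v = c *s m u v" "m u (c *s v) = c *s m u v" for u v w c
    using assms by (simp_all add: Bil_def clin_iff)
  have "m x y = m (x$1 *s e1 + x$2 *s e2) (y$1 *s e1 + y$2 *s e2)" using e by metis
  also have "\<dots> = bil (m e1 e1) (m e1 e2) (m e2 e1) (m e2 e2) x y"
    by (simp add: a bil_def vec_eq_iff algebra_simps)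
  finally show ?thesis .
qed

lemma regular_bil:
  assumes r: "regular a" "regular b" "regular c" "regular d" "regular u" "regular v"
  shows "regular (\<lambda>p. bil (a p) (b p) (c p) (d p) (u p) (v p))"
  unfolding regular_def
proof
  fix k
  obtain A where A: "A \<in> PolyFun" "\<forall>p\<in>Bil \<times> Bil. a p $ k = A p"
    using r(1) unfolding regular_def by blast
  obtain B where B: "B \<in> PolyFun" "\<forall>p\<in>Bil \<times> Bil. b p $ k = B p"
    using r(2) unfolding regular_def by blast
  obtain C where C: "C \<in> PolyFun" "\<forall>p\<in>Bil \<times> Bil. c p $ k = C p"
    using r(3) unfolding regular_def by blast
  obtain D where D: "D \<in> PolyFun" "\<forall>p\<in>Bil \<times> Bil. d p $ k = D p"
    using r(4) unfolding regular_def by blast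
  obtain U where U: "\<And>i. U i \<in> PolyFun" "\<And>i. \<forall>p\<in>Bil \<times> Bil. u p $ i = U i p"
    using r(5) unfolding regular_def by metis
  obtain V where V: "\<And>i. V i \<in> PolyFun" "\<And>i. \<forall>p\<in>Bil \<times> Bil. v p $ i = V i p"
    using r(6) unfolding regular_def by metis
  let ?h = "\<lambda>p. U 1 p * V 1 p * A p + U 1 p * V 2 p * B p + U 2 p * V 1 p * C p
    + U 2 p * V 2 p * D p"
  have "?h \<in> PolyFun" by (intro PolyFun.add PolyFun.mult A(1) B(1) C(1) D(1) U(1) V(1))
  moreover have "bil (a p) (b p) (c p) (d p) (u p) (v p) $ k = ?h p" if "p \<in> Bil \<times> Bil" for p
    using A(2)[rule_format, OF that] B(2)[rule_format, OF that] C(2)[rule_format, OF that]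
      D(2)[rule_format, OF that] U(2)[rule_format, OF that] V(2)[rule_format, OF that]
    by (simp add: bil_def)
  ultimately show "\<exists>h\<in>PolyFun. \<forall>p\<in>Bil \<times> Bil. bil (a p) (b p) (c p) (d p) (u p) (v p) $ k = h p"
    by (intro bexI[of _ ?h]) auto
qed

lemma regular_cong:
  "regular u \<Longrightarrow> (\<And>p. p \<in> Bil \<times> Bil \<Longrightarrow> v p = u p) \<Longrightarrow> regular v"
  unfolding regular_def by metis

lemma regular_fst_axis: "regular (\<lambda>p. fst p (axis i 1) (axis j 1))"
  unfolding regular_def by (rule allI, rule bexI[OF _ PolyFun.coord_fst[of i j]], rule ballI, rule refl)

lemma regular_fst:
  assumes "regular u" "regular v" shows "regular (\<lambda>p. fst p (u p) (v p))"
proof (rule regular_cong)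
  show "regular (\<lambda>p. bil (fst p e1 e1) (fst p e1 e2) (fst p e2 e1) (fst p e2 e2) (u p) (v p))"
    unfolding e1_def e2_def by (intro regular_bil regular_fst_axis assms)
qed (use Bil_expand in auto)

lemma regular_snd_axis: "regular (\<lambda>p. snd p (axis i 1) (axis j 1))"
  unfolding regular_def by (rule allI, rule bexI[OF _ PolyFun.coord_snd[of i j]], rule ballI, rule refl)

lemma regular_snd:
  assumes "regular u" "regular v" shows "regular (\<lambda>p. snd p (u p) (v p))"
proof (rule regular_cong)
  show "regular (\<lambda>p. bil (snd p e1 e1) (snd p e1 e2) (snd p e2 e1) (snd p e2 e2) (u p) (v p))"
    unfolding e1_def e2_def by (intro regular_bil regular_snd_axis assms)
qed (use Bil_expand in auto)

lemma closedin_eq: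
  assumes "regular u" "regular v"
  shows "closedin zariski {p \<in> Bil \<times> Bil. u p = v p}"
proof -
  obtain U where U: "\<And>i. U i \<in> PolyFun" "\<And>i. \<forall>p\<in>Bil \<times> Bil. u p $ i = U i p"
    using assms(1) unfolding regular_def by metis
  obtain V where V: "\<And>i. V i \<in> PolyFun" "\<And>i. \<forall>p\<in>Bil \<times> Bil. v p $ i = V i p"
    using assms(2) unfolding regular_def by metis
  let ?F = "range (\<lambda>i p. U i p + (-1) * V i p)"
  have "(\<lambda>p. U i p + (-1) * V i p) \<in> PolyFun" for i
    by (intro PolyFun.add PolyFun.mult[OF PolyFun.const] U(1) V(1))
  then have "?F \<subseteq> PolyFun" by blast
  moreover have "{p \<in> Bil \<times> Bil. u p = v p} = zeros ?F"
    using U V by (auto simp: zeros_def vec_eq_iff)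
  ultimately show ?thesis unfolding closedin_zariski by blast
qed

lemma closedin_LP: "closedin zariski LP"
proof -
  have eq: "LP = (\<Inter>x. \<Inter>y. \<Inter>z.
      {p \<in> Bil \<times> Bil. fst p x y = fst p y x} \<inter>
      {p \<in> Bil \<times> Bil. fst p (fst p x y) z = fst p x (fst p y z)} \<inter>
      {p \<in> Bil \<times> Bil. snd p (snd p x y) z = snd p (snd p x z) y + snd p x (snd p y z)} \<inter>
      {p \<in> Bil \<times> Bil. snd p (fst p x y) z = fst p (snd p x z) y + fst p x (snd p y z)})"
    (is "_ = ?R")
  proof (rule set_eqI)
    fix p :: bstruct
    obtain m n where "p = (m, n)" by force
    then show "p \<in> LP \<longleftrightarrow> p \<in> ?R"
      by (simp only: LP_iff INT_iff Int_iff mem_Collect_eq mem_Sigma_iff fst_conv snd_conv) blast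
  qed
  show ?thesis
    unfolding eq by (intro closedin_INT closedin_Int closedin_eq regular_fst regular_snd
        regular_add regular_const UNIV_not_empty)
qed

lemma zcl_eq: "S \<subseteq> LP \<Longrightarrow> zcl S = zariski closure_of S"
  unfolding zcl_def closure_of_subtopology
  by (metis closedin_LP closure_of_minimal inf.absorb2)

end

theory Submission
  imports Defs
begin

text \<open>Every inclusion comes from a degeneration along a curve: for \<open>t \<noteq> 0\<close> one picks a parameter
  \<open>\<beta> t\<close> and a basis \<open>E1 t, E2 t\<close>, possibly singular at \<open>t = 0\<close>, in which the structure constants
  of \<open>L (\<beta> t)\<close> extend continuously to \<open>t = 0\<close>. A polynomial that vanishes on the orbits then
  vanishes at the limit by continuity. Applying a fixed \<open>g\<close> to the whole curve reaches the orbit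
  of the limit.\<close>

definition frame :: "vec2 \<Rightarrow> vec2 \<Rightarrow> vec2 \<Rightarrow> vec2"
  where "frame a b x = x$1 *s a + x$2 *s b"

text \<open>The assumption says that the matrix with columns \<open>a\<close> and \<open>b\<close>
  has nonzero determinant.\<close>

lemma frame_in_GL:
  assumes "a$1 * b$2 \<noteq> a$2 * b$1"
  shows "frame a b \<in> GL"
proof -
  define d where "d = a$1 * b$2 - a$2 * b$1"
  have d: "d \<noteq> 0" using assms by (simp add: d_def)
  \<comment> \<open>The adjugate matrix divided by the determinant; \<open>d\<close> stays folded
    until the denominators are cleared.\<close>
  define k :: "vec2 \<Rightarrow> vec2" where
    "k = frame (vector [b$2 / d, - a$2 / d]) (vector [- b$1 / d, a$1 / d])"
  have "k \<circ> frame a b = id" "frame a b \<circ> k = id"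
    using d by (auto simp: fun_eq_iff k_def frame_def vec_eq_iff forall_2 field_simps)
      (auto simp: d_def algebra_simps)
  then have "bij (frame a b)" by (rule o_bij)
  moreover have "clin (frame a b)"
    by (simp add: clin_iff frame_def vec_eq_iff algebra_simps)
  ultimately show ?thesis by (simp add: GL_def)
qed

text \<open>\<open>inv h\<close> passes to the basis given by \<open>h\<close>, then
  \<open>g\<close> moves the result. The inverse is computed because \<open>act\<close> applies it
  to the arguments.\<close>

lemma GL_comp_inv:
  assumes "g \<in> GL" "h \<in> GL"
  shows "g \<circ> inv h \<in> GL" "inv (g \<circ> inv h) = h \<circ> inv g"
proof -
  have b: "bij g" "bij h" and l: "clin g" "clin h" using assms by (auto simp: GL_def)
  have i: "h (inv h x) = x" "inv h (h x) = x" for x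
    using b(2) by (simp_all add: bij_is_inj bij_is_surj surj_f_inv_f)
  have "inv h (x + y) = inv h x + inv h y" "inv h (c *s x) = c *s inv h x" for x y c
    using l(2) unfolding clin_iff by (metis i)+
  then have "clin (g \<circ> inv h)" using l(1) unfolding clin_iff by simp
  moreover have "bij (g \<circ> inv h)" using b by (simp add: bij_comp bij_imp_bij_inv)
  ultimately show "g \<circ> inv h \<in> GL" by (simp add: GL_def)
  show "inv (g \<circ> inv h) = h \<circ> inv g"
    using b by (simp add: o_inv_distrib bij_imp_bij_inv inv_inv_eq)
qed

text \<open>Complex linearity implies real linearity, which gives continuity in finite
  dimension.\<close>

lemma clin_isCont:
  assumes "clin g"
  shows "isCont g x"
proof -
  have "linear g"
  proof
    show "g (r *\<^sub>R y) = r *\<^sub>R g y" for r y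
    proof -
      have "r *\<^sub>R y = of_real r *s y" "r *\<^sub>R g y = of_real r *s g y"
        by (simp_all add: vec_eq_iff scaleR_conv_of_real[where 'a=complex])
      then show ?thesis using assms by (simp add: clin_iff)
    qed
  qed (use assms in \<open>simp add: clin_iff\<close>)
  then show ?thesis by (simp add: linear_continuous_at linear_linear)
qed

lemma PolyFun_isCont:
  assumes "f \<in> PolyFun"
    and "\<And>x y. isCont (\<lambda>t. fst (P t) x y) a" "\<And>x y. isCont (\<lambda>t. snd (P t) x y) a"
  shows "isCont (\<lambda>t. f (P t)) a"
  using assms(1) by induction (auto intro!: continuous_intros assms(2,3))

text \<open>By \<open>hom\<close>, \<open>h t\<close> is an isomorphism from \<open>q t\<close> to
  \<open>L (\<beta> t)\<close>. Only \<open>q\<close> has to make sense at \<open>t = 0\<close>;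
  \<open>h\<close> may become singular there and \<open>\<beta>\<close> may have a pole.\<close>

lemma degeneration:
  fixes q :: "complex \<Rightarrow> bstruct"
  assumes GL: "\<And>t. t \<noteq> 0 \<Longrightarrow> h t \<in> GL"
    and hom: "\<And>t x y. t \<noteq> 0 \<Longrightarrow> fst (L (\<beta> t)) (h t x) (h t y) = h t (fst (q t) x y)"
      "\<And>t x y. t \<noteq> 0 \<Longrightarrow> snd (L (\<beta> t)) (h t x) (h t y) = h t (snd (q t) x y)"
    and cont: "\<And>x y. isCont (\<lambda>t. fst (q t) x y) 0" "\<And>x y. isCont (\<lambda>t. snd (q t) x y) 0"
    and lim: "q 0 = T" "T \<in> LP"
    and LP: "\<And>b. L b \<in> LP"
  shows "zcl (orbit T) \<subseteq> zcl (\<Union>b. orbit (L b))"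
proof -
  let ?S = "\<Union>b. orbit (L b)"
  have S: "?S \<subseteq> LP" using orbit_LP LP by blast
  have "p \<in> zariski closure_of ?S" if p: "p \<in> orbit T" for p
  proof -
    obtain g where g: "g \<in> GL" "p = act g (q 0)"
      using p unfolding orbit_def lim(1)[symmetric] by blast
    have on_curve: "act g (q t) \<in> ?S" if t: "t \<noteq> 0" for t
    proof -
      obtain m n where q: "q t = (m, n)" by force
      obtain m' n' where L: "L (\<beta> t) = (m', n')" by force
      have "inv (h t) (h t x) = x" for x
        using GL[OF t] by (simp add: GL_def bij_is_inj)
      \<comment> \<open>\<open>inv (h t)\<close> takes \<open>L (\<beta> t)\<close> to
        \<open>q t\<close>, and \<open>g\<close> then takes this to
        \<open>act g (q t)\<close>.\<close>
      then have "act (g \<circ> inv (h t)) (L (\<beta> t)) = act g (q t)"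
        using hom[OF t] by (simp add: q L GL_comp_inv(2)[OF g(1) GL[OF t]])
      then show ?thesis
        using GL_comp_inv(1)[OF g(1) GL[OF t]]
        unfolding orbit_def by (intro UN_I[OF UNIV_I] image_eqI) (rule sym)
    qed
    \<comment> \<open>A closed \<open>Z\<close> comes with defining polynomials \<open>F\<close>; at
      the end \<open>Z\<close> is the closure of \<open>?S\<close> itself.\<close>
    have "p \<in> Z" if Z: "closedin zariski Z" "?S \<subseteq> Z" for Z
    proof -
      obtain F where F: "F \<subseteq> PolyFun" "Z = zeros F"
        using Z(1) closedin_zariski by blast
      have "f p = 0" if f: "f \<in> F" for f
      proof -
        have act: "fst (act g r) x y = g (fst r (inv g x) (inv g y))"
          "snd (act g r) x y = g (snd r (inv g x) (inv g y))" for r x y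
          by (cases r; simp)+
        have gc: "isCont g x" for x using g(1) by (simp add: GL_def clin_isCont)
        have "isCont (\<lambda>t. f (act g (q t))) 0"
        proof (rule PolyFun_isCont)
          show "f \<in> PolyFun" using F(1) f by blast
        qed (unfold act, (rule isCont_o2[OF cont(1) gc] isCont_o2[OF cont(2) gc])+)
        moreover have "f (act g (q t)) = 0" if "t \<noteq> 0" for t
          using on_curve[OF that] Z(2) f by (auto simp: F(2) zeros_def)
        \<comment> \<open>The punctured limit ignores \<open>t = 0\<close>, so uniqueness of limits
          forces the value there, which is \<open>f p\<close>, to be 0.\<close>
        then have "((\<lambda>t. f (act g (q t))) \<longlongrightarrow> 0) (at 0)"
          by (intro tendsto_eventually) (simp add: eventually_at_filter)
        ultimately show ?thesis
          unfolding g(2) isCont_def by (rule LIM_unique)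
      qed
      moreover have "p \<in> Bil \<times> Bil"
        using orbit_LP[OF lim(2)] p by (auto simp: LP_def)
      ultimately show ?thesis by (simp add: F(2) zeros_def)
    qed
    note in_closed = this
    have "?S \<subseteq> topspace zariski"
      using S by (force simp: topspace_zariski LP_def)
    then show ?thesis
      by (intro in_closed closedin_closure_of closure_of_subset)
  qed
  then have "zariski closure_of orbit T \<subseteq> zariski closure_of ?S"
    by (intro closure_of_minimal closedin_closure_of subsetI)
  then show ?thesis by (simp add: zcl_eq S orbit_LP lim(2))
qed

text \<open>In coordinates, each condition on a frame becomes a rational identity in
  \<open>t\<close>.\<close>

lemmas coordinate_simps = L1_def L2_def L5_def L6_def L7_def C8_def
  bil_def frame_def e1_def e2_def axis_def vec_eq_iff forall_2
  power2_eq_square divide_simps algebra_simps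

lemma isCont_bil:
  assumes "isCont a s" "isCont b s" "isCont c s" "isCont d s"
  shows "isCont (\<lambda>t. bil (a t) (b t) (c t) (d t) x y) s"
  using assms unfolding isCont_def bil_def
  by (intro vec_tendstoI) (auto intro!: tendsto_intros)

lemma isCont_vector_scalar_mult:
  fixes f :: "complex \<Rightarrow> complex" and v :: "complex \<Rightarrow> vec2"
  assumes "isCont f s" "isCont v s"
  shows "isCont (\<lambda>t. f t *s v t) s"
  using assms unfolding isCont_def
  by (intro vec_tendstoI) (auto intro!: tendsto_intros)

text \<open>With \<open>E1 = t e1 + e2\<close> and \<open>E2 = t e2\<close>, the square of
  \<open>E1\<close> is \<open>t E1 + E2\<close> and \<open>[E1, E1] = \<alpha> E2\<close>.\<close>

lemma L5_to_L7: "zcl (orbit (L7 \<alpha>)) \<subseteq> zcl (\<Union>\<beta>. orbit (L5 \<beta>))"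
  by (rule degeneration[where h = "\<lambda>t. frame (t *s e1 + e2) (t *s e2)" and \<beta> = "\<lambda>t. \<alpha>"
        and q = "\<lambda>t. (bil (t *s e1 + e2) (t *s e2) (t *s e2) 0,
          bil (\<alpha> *s e2) 0 ((\<alpha> * t) *s e2) 0)",
        OF _ _ _ _ _ _ structures_in_LP(5) structures_in_LP(3)])
    (auto intro!: frame_in_GL isCont_bil isCont_vector_scalar_mult continuous_intros
      simp: coordinate_simps)

text \<open>The pole of \<open>\<beta>\<close> cancels the factor \<open>t\<close> in
  \<open>E2 = t e1\<close>: the bracket survives while the products shrink.\<close>

lemma L5_to_L2: "zcl (orbit L2) \<subseteq> zcl (\<Union>\<beta>. orbit (L5 \<beta>))"
  by (rule degeneration[where h = "\<lambda>t. frame e2 (t *s e1)" and \<beta> = "\<lambda>t. 1 / t"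
        and q = "\<lambda>t. (bil 0 (t *s e1) (t *s e1) (t *s e2), bil 0 e1 0 0)",
        OF _ _ _ _ _ _ structures_in_LP(2) structures_in_LP(3)])
    (auto intro!: frame_in_GL isCont_bil isCont_vector_scalar_mult continuous_intros
      simp: coordinate_simps)

text \<open>The weight \<open>t\<^sup>2\<close> on \<open>e1\<close> gives
  \<open>[E1, E1] = t\<^sup>2 \<beta> e2 = E2\<close>, yet leaves only the vanishing coefficient
  \<open>t\<close> at \<open>E2\<close> in the square of \<open>E1\<close>.\<close>

lemma L5_to_L1: "zcl (orbit L1) \<subseteq> zcl (\<Union>\<beta>. orbit (L5 \<beta>))"
  by (rule degeneration[where h = "\<lambda>t. frame (t\<^sup>2 *s e1 + e2) (t *s e2)" and \<beta> = "\<lambda>t. 1 / t"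
        and q = "\<lambda>t. (bil (t\<^sup>2 *s e1 + t *s e2) (t\<^sup>2 *s e2) (t\<^sup>2 *s e2) 0,
          bil e2 0 (t *s e2) 0)",
        OF _ _ _ _ _ _ structures_in_LP(1) structures_in_LP(3)])
    (auto intro!: frame_in_GL isCont_bil isCont_vector_scalar_mult continuous_intros
      simp: coordinate_simps)

text \<open>Scaling the basis by \<open>t\<close> multiplies all structure constants by
  \<open>t\<close>.\<close>

lemma L5_to_C8: "zcl (orbit C8) \<subseteq> zcl (\<Union>\<beta>. orbit (L5 \<beta>))"
  by (rule degeneration[where h = "\<lambda>t. frame (t *s e1) (t *s e2)" and \<beta> = "\<lambda>t. 0"
        and q = "\<lambda>t. (bil (t *s e1) (t *s e2) (t *s e2) 0, bil 0 0 0 0)",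
        OF _ _ _ _ _ _ structures_in_LP(6) structures_in_LP(3)])
    (auto intro!: frame_in_GL isCont_bil isCont_vector_scalar_mult continuous_intros
      simp: coordinate_simps)

text \<open>Here \<open>e1\<close> annihilates \<open>e2\<close> in the product, so the square of
  \<open>E1\<close> is \<open>t E1 - t e2\<close>. The sign in \<open>E2 = - t e2\<close> turns this
  into \<open>t E1 + E2\<close>, and \<open>\<beta> = - \<alpha>\<close> corrects the
  bracket.\<close>

lemma L6_to_L7: "zcl (orbit (L7 \<alpha>)) \<subseteq> zcl (\<Union>\<beta>. orbit (L6 \<beta>))"
  by (rule degeneration[where h = "\<lambda>t. frame (t *s e1 + e2) ((- t) *s e2)" and \<beta> = "\<lambda>t. - \<alpha>"
        and q = "\<lambda>t. (bil (t *s e1 + e2) 0 0 0,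
          bil (\<alpha> *s e2) 0 ((- \<alpha> * t) *s e2) 0)",
        OF _ _ _ _ _ _ structures_in_LP(5) structures_in_LP(4)])
    (auto intro!: frame_in_GL isCont_bil isCont_vector_scalar_mult continuous_intros
      simp: coordinate_simps)

lemma L6_to_L2: "zcl (orbit L2) \<subseteq> zcl (\<Union>\<beta>. orbit (L6 \<beta>))"
  by (rule degeneration[where h = "\<lambda>t. frame e2 (t *s e1)" and \<beta> = "\<lambda>t. 1 / t"
        and q = "\<lambda>t. (bil 0 0 0 (t *s e2), bil 0 e1 0 0)",
        OF _ _ _ _ _ _ structures_in_LP(2) structures_in_LP(4)])
    (auto intro!: frame_in_GL isCont_bil isCont_vector_scalar_mult continuous_intros
      simp: coordinate_simps)

lemma L6_to_L1: "zcl (orbit L1) \<subseteq> zcl (\<Union>\<beta>. orbit (L6 \<beta>))"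
  by (rule degeneration[where h = "\<lambda>t. frame (t\<^sup>2 *s e1 + e2) (t *s e2)" and \<beta> = "\<lambda>t. 1 / t"
        and q = "\<lambda>t. (bil (t\<^sup>2 *s e1 + (- t) *s e2) 0 0 0,
          bil e2 0 (t *s e2) 0)",
        OF _ _ _ _ _ _ structures_in_LP(1) structures_in_LP(4)])
    (auto intro!: frame_in_GL isCont_bil isCont_vector_scalar_mult continuous_intros
      simp: coordinate_simps)

lemma L6_to_C8: "zcl (orbit C8) \<subseteq> zcl (\<Union>\<beta>. orbit (L6 \<beta>))"
  by (rule degeneration[where h = "\<lambda>t. frame (t *s e1) (t *s e2)" and \<beta> = "\<lambda>t. 0"
        and q = "\<lambda>t. (bil (t *s e1) 0 0 0, bil 0 0 0 0)",
        OF _ _ _ _ _ _ structures_in_LP(6) structures_in_LP(4)])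
    (auto intro!: frame_in_GL isCont_bil isCont_vector_scalar_mult continuous_intros
      simp: coordinate_simps)

text \<open>Scaling by \<open>t\<close> shrinks both operations; \<open>\<beta> = 1 / t\<close>
  restores the bracket alone.\<close>

lemma L7_to_L1: "zcl (orbit L1) \<subseteq> zcl (\<Union>\<beta>. orbit (L7 \<beta>))"
  by (rule degeneration[where h = "\<lambda>t. frame (t *s e1) (t *s e2)" and \<beta> = "\<lambda>t. 1 / t"
        and q = "\<lambda>t. (bil (t *s e2) 0 0 0, bil e2 0 0 0)",
        OF _ _ _ _ _ _ structures_in_LP(1) structures_in_LP(5)])
    (auto intro!: frame_in_GL isCont_bil isCont_vector_scalar_mult continuous_intros
      simp: coordinate_simps)

lemma L7_to_C8: "zcl (orbit C8) \<subseteq> zcl (\<Union>\<beta>. orbit (L7 \<beta>))"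
  by (rule degeneration[where h = "\<lambda>t. frame (t *s e1) (t *s e2)" and \<beta> = "\<lambda>t. 0"
        and q = "\<lambda>t. (bil (t *s e2) 0 0 0, bil 0 0 0 0)",
        OF _ _ _ _ _ _ structures_in_LP(6) structures_in_LP(5)])
    (auto intro!: frame_in_GL isCont_bil isCont_vector_scalar_mult continuous_intros
      simp: coordinate_simps)

theorem lemma20:
  shows
   "((\<forall>\<alpha>. zcl (orbit (L7 \<alpha>)) \<subseteq> zcl (\<Union>\<beta>. orbit (L5 \<beta>)))
      \<and> zcl (orbit L2) \<subseteq> zcl (\<Union>\<beta>. orbit (L5 \<beta>))
      \<and> zcl (orbit L1) \<subseteq> zcl (\<Union>\<beta>. orbit (L5 \<beta>))
      \<and> zcl (orbit C8) \<subseteq> zcl (\<Union>\<beta>. orbit (L5 \<beta>)))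
    \<and> ((\<forall>\<alpha>. zcl (orbit (L7 \<alpha>)) \<subseteq> zcl (\<Union>\<beta>. orbit (L6 \<beta>)))
      \<and> zcl (orbit L2) \<subseteq> zcl (\<Union>\<beta>. orbit (L6 \<beta>))
      \<and> zcl (orbit L1) \<subseteq> zcl (\<Union>\<beta>. orbit (L6 \<beta>))
      \<and> zcl (orbit C8) \<subseteq> zcl (\<Union>\<beta>. orbit (L6 \<beta>)))
    \<and> (zcl (orbit L1) \<subseteq> zcl (\<Union>\<beta>. orbit (L7 \<beta>))
      \<and> zcl (orbit C8) \<subseteq> zcl (\<Union>\<beta>. orbit (L7 \<beta>)))"
  by (intro conjI allI L5_to_L7 L5_to_L2 L5_to_L1 L5_to_C8
      L6_to_L7 L6_to_L2 L6_to_L1 L6_to_C8 L7_to_L1 L7_to_C8)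

end
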